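(* Let $T\in(0,\infty)$ and let $\boldsymbol{X}^n$ be the occupancy process of the JSQ$(d_n)$ system described in the context, where $d_n\in\{1,\dots,n\}$, $d_n\to\infty$, $\lambda_n\to1$, and $\boldsymbol{X}^n(0)=(1,0,0,\dots)$ for all $n\in\mathbb{N}$. Let $U^n_3=\{X^n_3(t)>0\text{ for some }t\in[0,T]\}$. If $d_n=o(n)$ as $n\to\infty$, then $$\lim_{n\to\infty}\frac1n\log\mathbb{P}(U^n_3)=0,$$ and consequently $$\liminf_{n\to\infty}\frac1n\log\mathbb{P}(U^n_3)>-T\,\ell\!\left(\frac{\frac1T+\sqrt{4+\frac1{T^2}}}{2}\right)-T\,\ell\!\left(\frac{-\frac1T+\sqrt{4+\frac1{T^2}}}{2}\right).$$
   Context: JSQ$(d_n)$ system: $n$ parallel single-server queues; jobs arrive according to a Poisson process of rate $n\lambda_n$; service times are i.i.d. exponential with mean 1, independent of the arrivals, FIFO at each server; each arriving job samples $d_n$ of the $n$ queues uniformly at random without replacement and joins the shortest of them (ties broken uniformly at random). For $i\ge1$, $X^n_i(t)$ is the proportion of the $n$ queues that have length at least $i$ at time $t$, and $\boldsymbol{X}^n(t)=(X^n_i(t))_{i\ge1}$. $\ell(z)=z\log z-z+1$ for $z\ge0$. *)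

theory Defs
  imports "HOL-Probability.Probability" "HOL-Library.Landau_Symbols"
begin

definition ell :: "real \<Rightarrow> real" where
  "ell z = z * ln z - z + 1"

text \<open>Logarithm of a probability, with \<open>log 0 = -\<infinity>\<close> (the library has \<open>ln 0 = 0\<close>).\<close>

definition elog :: "real \<Rightarrow> ereal" where
  "elog p = (if p \<le> 0 then -\<infinity> else ereal (ln p))"


section \<open>The queueing dynamics along one sample path\<close>

text \<open>
  Servers are \<open>0, \<dots>, n - 1\<close>. Jobs are numbered in their order of arrival: the jobs
  \<open>j < length init\<close> are present at time 0, job \<open>j\<close> at server \<open>init ! j\<close>, and job
  \<open>length init + k\<close> is the \<open>k\<close>-th arrival (from \<open>k = 0\<close>). The primitive data are the
  interarrival times, the service times of all jobs (initial ones included), the set of servers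
  sampled by each arrival, and a number in \<open>[0,1)\<close> with which each arrival breaks ties.
\<close>

record jsq_input =
  interarrival :: "nat \<Rightarrow> real"
  service :: "nat \<Rightarrow> real"
  sampled :: "nat \<Rightarrow> nat set"
  tie :: "nat \<Rightarrow> real"

definition arrival_time :: "nat list \<Rightarrow> jsq_input \<Rightarrow> nat \<Rightarrow> real" where
  "arrival_time init w j =
     (if j < length init then 0 else (\<Sum>k\<le>j - length init. interarrival w k))"

text \<open>The members of \<open>B\<close> minimising \<open>len\<close>.\<close>

definition shortest :: "nat set \<Rightarrow> (nat \<Rightarrow> nat) \<Rightarrow> nat set" where
  "shortest B len = {s \<in> B. \<forall>s' \<in> B. len s \<le> len s'}"

text \<open>If \<open>u\<close> is uniform on \<open>[0,1)\<close>, this is a uniformly chosen element of the finite set \<open>B\<close>.\<close>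

definition pick :: "real \<Rightarrow> nat set \<Rightarrow> nat" where
  "pick u B = sorted_list_of_set B ! nat \<lfloor>u * real (card B)\<rfloor>"

text \<open>
  \<open>server_of j\<close> is the server joined by job \<open>j\<close>: the lengths it compares count the earlier jobs
  at each server that have not departed at its arrival time. \<open>departure_time j\<close> is the time at
  which job \<open>j\<close> leaves: under FIFO its service starts once it has arrived and all earlier jobs
  at its server have left.
\<close>

context
  notes conj_cong [fundef_cong]
begin

function server_of :: "nat list \<Rightarrow> jsq_input \<Rightarrow> nat \<Rightarrow> nat"
  and departure_time :: "nat list \<Rightarrow> jsq_input \<Rightarrow> nat \<Rightarrow> real" where
  "server_of init w j =
     (if j < length init then init ! j
      else pick (tie w (j - length init))
             (shortest (sampled w (j - length init))
               (\<lambda>s. card {m. m < j \<and> server_of init w m = s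
                             \<and> arrival_time init w j < departure_time init w m})))"
| "departure_time init w j =
     Max (insert (arrival_time init w j)
            ((\<lambda>m. departure_time init w m) `
               {m. m < j \<and> server_of init w m = server_of init w j}))
       + service w j"
  by pat_completeness auto
termination
  by (relation "Wellfounded.measure (case_sum (\<lambda>(init, w, j). 2 * j) (\<lambda>(init, w, j). 2 * j + 1))") auto

end

declare server_of.simps [simp del] departure_time.simps [simp del]

definition jobs_present :: "nat list \<Rightarrow> jsq_input \<Rightarrow> real \<Rightarrow> nat \<Rightarrow> nat set" where
  "jobs_present init w t s =
     {j. server_of init w j = s \<and> arrival_time init w j \<le> t \<and> t < departure_time init w j}"

text \<open>
  The length is infinite only if arrivals accumulate before time \<open>t\<close>, a null event for Poisson
  arrivals.
\<close>

definition queue_length :: "nat list \<Rightarrow> jsq_input \<Rightarrow> real \<Rightarrow> nat \<Rightarrow> enat" where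
  "queue_length init w t s =
     (if finite (jobs_present init w t s) then enat (card (jobs_present init w t s)) else \<infinity>)"

definition occupancy :: "nat \<Rightarrow> nat list \<Rightarrow> jsq_input \<Rightarrow> nat \<Rightarrow> real \<Rightarrow> real" where
  "occupancy n init w i t =
     real (card {s. s < n \<and> enat i \<le> queue_length init w t s}) / real n"


section \<open>The random primitives\<close>

datatype primitive = Interarrival nat | Service nat | Sampled nat | Tie nat

definition server_samples :: "nat \<Rightarrow> nat \<Rightarrow> nat set set" where
  "server_samples n d = {B. B \<subseteq> {..<n} \<and> card B = d}"

text \<open>
  The sigma-algebra generated by each primitive. Mutual independence is stated through these
  because the primitives do not all take values in the same type, as
  \<^const>\<open>prob_space.indep_vars\<close> would require.
\<close>

fun primitive_events ::
  "'a measure \<Rightarrow> nat \<Rightarrow> nat \<Rightarrow> ('a \<Rightarrow> jsq_input) \<Rightarrow> primitive \<Rightarrow> 'a set set" where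
  "primitive_events M n d W (Interarrival k) =
     {(\<lambda>\<omega>. interarrival (W \<omega>) k) -` B \<inter> space M |B. B \<in> sets borel}"
| "primitive_events M n d W (Service k) =
     {(\<lambda>\<omega>. service (W \<omega>) k) -` B \<inter> space M |B. B \<in> sets borel}"
| "primitive_events M n d W (Sampled k) =
     {(\<lambda>\<omega>. sampled (W \<omega>) k) -` B \<inter> space M |B. B \<in> sets (count_space (server_samples n d))}"
| "primitive_events M n d W (Tie k) =
     {(\<lambda>\<omega>. tie (W \<omega>) k) -` B \<inter> space M |B. B \<in> sets borel}"

text \<open>
  The Poisson arrival process of rate \<open>n * lam\<close> is given by its i.i.d. exponential interarrival
  times. By memorylessness the residual service times of the initial jobs are also exponential
  with mean 1.
\<close>

locale jsq_system = prob_space M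
  for M :: "'a measure" and n d :: nat and lam :: real and init :: "nat list"
    and W :: "'a \<Rightarrow> jsq_input" +
  assumes servers: "1 \<le> n"
    and samples: "1 \<le> d" "d \<le> n"
    and rate_pos: "0 < lam"
    and initial_servers: "set init \<subseteq> {..<n}"
    and interarrival_dist:
      "\<And>k. distributed M lborel (\<lambda>\<omega>. interarrival (W \<omega>) k) (exponential_density (real n * lam))"
    and service_dist:
      "\<And>j. distributed M lborel (\<lambda>\<omega>. service (W \<omega>) j) (exponential_density 1)"
    and sampled_measurable:
      "\<And>k. (\<lambda>\<omega>. sampled (W \<omega>) k) \<in> measurable M (count_space (server_samples n d))"
    and sampled_dist:
      "\<And>k. distr M (count_space (server_samples n d)) (\<lambda>\<omega>. sampled (W \<omega>) k)
             = uniform_count_measure (server_samples n d)"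
    and tie_measurable: "\<And>k. (\<lambda>\<omega>. tie (W \<omega>) k) \<in> borel_measurable M"
    and tie_dist:
      "\<And>k. distr M lborel (\<lambda>\<omega>. tie (W \<omega>) k) = uniform_measure lborel {0..<1}"
    and primitives_independent: "indep_sets (primitive_events M n d W) UNIV"

text \<open>The event that \<open>X\<^sub>i\<close> becomes positive during \<open>[0,T]\<close>.\<close>

definition reach_event ::
  "'a measure \<Rightarrow> nat \<Rightarrow> nat list \<Rightarrow> ('a \<Rightarrow> jsq_input) \<Rightarrow> real \<Rightarrow> nat \<Rightarrow> 'a set" where
  "reach_event M n init W T i =
     {\<omega> \<in> space M. \<exists>t\<in>{0..T}. occupancy n init (W \<omega>) i t > 0}"

end

(* Give the first d + 1 jobs a small time delta to arrive, and keep all departures away from [0,delta].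
   If no queue has reached length 3 after d arrivals, then exactly d queues have length 2, and the next job creates a queue of length 3 as soon as it samples precisely
   these d servers. The latter has conditional probability 1 / binomial n d, which is exp (- o(n))
   because d = o(n); early arrivals cost a factor exp (- O(d)), and late departures cost
   exp (- delta (n + d + 1)). Finally let delta tend to 0. *)

theory Submission
  imports Defs "HOL-Real_Asymp.Real_Asymp"
begin

text \<open>The set of servers to be hit is itself random: it depends on earlier samples, ties,
  services and arrival times. It is, however, a function of the primitives other than the sample of
  arrival \<open>d\<close>, so that sample is independent of it and uniform, and summing over its
  possible values yields the factor one over the binomial coefficient. If a third job has already
  joined some server, nothing more is required of this sample; a fixed dummy target is prescribed
  nevertheless, so that the probability stays an exact product. The combinatorics speaks of jobs
  that ever joined a server, not of queue lengths; times enter only when three such jobs are shown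
  to be present together. With \<open>x = d / n\<close>, the binomial coefficient is at most
  \<open>exp (n * (x - x * ln x))\<close>, and \<open>x * ln x\<close> vanishes as \<open>x\<close>
  tends to 0. Each of the \<open>d + 1\<close> gaps is required to be at most
  \<open>\<delta> / (d + 1)\<close>; since \<open>d = o(n)\<close>, the mean number of arrivals in a
  slot of that length tends to infinity, so each gap costs at most a factor 1/2. The second claim
  follows because the stated exponent is strictly negative for every \<open>T > 0\<close>.\<close>

section \<open>Measurability of the queueing dynamics\<close>

lemma measurable_card_bounded_Collect:
  fixes P :: "'a \<Rightarrow> nat \<Rightarrow> bool"
  assumes "\<And>m. m < j \<Longrightarrow> Measurable.pred N (\<lambda>\<omega>. P \<omega> m)"
  shows "(\<lambda>\<omega>. card {m. m < j \<and> P \<omega> m}) \<in> measurable N (count_space UNIV)"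
proof -
  have "card {m. m < j \<and> P \<omega> m} = (\<Sum>m<j. if P \<omega> m then 1 else 0)" for \<omega>
  proof -
    have "{m. m < j \<and> P \<omega> m} = {m \<in> {..<j}. P \<omega> m}" by auto
    then show ?thesis by (simp add: sum.If_cases Int_def)
  qed
  moreover have "(\<lambda>\<omega>. \<Sum>m<j. if P \<omega> m then 1 else (0::nat)) \<in> measurable N (count_space UNIV)"
    using assms by (intro measurable_sum_nat measurable_If) (auto simp: pred_def)
  ultimately show ?thesis by simp
qed

lemma pred_le_nat:
  fixes f g :: "'a \<Rightarrow> nat"
  assumes f: "f \<in> measurable N (count_space UNIV)" and g: "g \<in> measurable N (count_space UNIV)"
  shows "Measurable.pred N (\<lambda>\<omega>. f \<omega> \<le> g \<omega>)"
proof (rule measurable_compose_countable'[OF _ g])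
  fix i
  show "Measurable.pred N (\<lambda>\<omega>. f \<omega> \<le> i)"
    by (rule measurable_compose[OF f]) simp
qed simp

lemma pred_eq_nat:
  fixes f g :: "'a \<Rightarrow> nat"
  assumes "f \<in> measurable N (count_space UNIV)" "g \<in> measurable N (count_space UNIV)"
  shows "Measurable.pred N (\<lambda>\<omega>. f \<omega> = g \<omega>)"
  unfolding order.eq_iff using assms by (intro pred_intros_logic pred_le_nat)

text \<open>Only finitely many values are possible, so preimages of single sets suffice, and
  equality with a given set is a finite conjunction of membership statements.\<close>

lemma measurable_set_valued:
  assumes S: "finite S" and sub: "\<And>\<omega>. \<omega> \<in> space N \<Longrightarrow> f \<omega> \<subseteq> S"
    and mem: "\<And>s. s \<in> S \<Longrightarrow> Measurable.pred N (\<lambda>\<omega>. s \<in> f \<omega>)"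
  shows "f \<in> measurable N (count_space (Pow S))"
proof (subst measurable_count_space_eq2, simp add: S, intro conjI ballI)
  show "f \<in> space N \<rightarrow> Pow S" using sub by auto
  fix A assume A: "A \<in> Pow S"
  have "f \<omega> = A \<longleftrightarrow> (\<forall>s\<in>S. s \<in> A \<longleftrightarrow> s \<in> f \<omega>)" if "\<omega> \<in> space N" for \<omega>
    using A sub[OF that] by blast
  then have "f -` {A} \<inter> space N = {\<omega> \<in> space N. \<forall>s\<in>S. s \<in> A \<longleftrightarrow> s \<in> f \<omega>}"
    by auto
  also have "\<dots> \<in> sets N"
    unfolding pred_def[symmetric] using S mem by (intro pred_intros_finite pred_intros_logic) simp_all
  finally show "f -` {A} \<inter> space N \<in> sets N" .
qed

lemma measurable_arrival_time:
  assumes "\<And>k. (\<lambda>\<omega>. interarrival (W \<omega>) k) \<in> borel_measurable N"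
  shows "(\<lambda>\<omega>. arrival_time init (W \<omega>) j) \<in> borel_measurable N"
  unfolding arrival_time_def using assms by (cases "j < length init") simp_all

text \<open>Strong induction along the mutual recursion. The samples are assumed measurable only for
  indices below \<open>K\<close>: this lets \<open>N\<close> be a sigma-algebra that ignores sample
  \<open>K\<close>, which is what the independence argument requires.\<close>

lemma measurable_server_of_departure_time:
  assumes inter: "\<And>k. (\<lambda>\<omega>. interarrival (W \<omega>) k) \<in> borel_measurable N"
    and serv: "\<And>k. (\<lambda>\<omega>. service (W \<omega>) k) \<in> borel_measurable N"
    and tie: "\<And>k. (\<lambda>\<omega>. tie (W \<omega>) k) \<in> borel_measurable N"
    and samp: "\<And>k. k < K \<Longrightarrow> (\<lambda>\<omega>. sampled (W \<omega>) k) \<in> measurable N (count_space (server_samples n d))"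
    and "j < length init + K"
  shows "(\<lambda>\<omega>. server_of init (W \<omega>) j) \<in> measurable N (count_space UNIV)"
    and "(\<lambda>\<omega>. departure_time init (W \<omega>) j) \<in> borel_measurable N"
proof -
  have "(\<lambda>\<omega>. server_of init (W \<omega>) j) \<in> measurable N (count_space UNIV) \<and>
    (\<lambda>\<omega>. departure_time init (W \<omega>) j) \<in> borel_measurable N"
    using \<open>j < length init + K\<close>
  proof (induction j rule: less_induct)
    case (less j)
    note arr [measurable] = measurable_arrival_time[where W = W, OF inter]
    have IHs [measurable]: "(\<lambda>\<omega>. server_of init (W \<omega>) m) \<in> measurable N (count_space UNIV)"
      and IHd [measurable]: "(\<lambda>\<omega>. departure_time init (W \<omega>) m) \<in> borel_measurable N"
      if "m < j" for m
      using less that by auto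
    have S [measurable]: "(\<lambda>\<omega>. server_of init (W \<omega>) j) \<in> measurable N (count_space UNIV)"
    proof (cases "j < length init")
      case True
      then show ?thesis by (subst server_of.simps) simp
    next
      case False
      define k where "k = j - length init"
      have "k < K" using False less.prems by (auto simp: k_def)
      note sk = samp[OF this]
      define L where "L \<omega> s = card {m. m < j \<and> (server_of init (W \<omega>) m = s
        \<and> arrival_time init (W \<omega>) j < departure_time init (W \<omega>) m)}" for \<omega> s
      have L: "(\<lambda>\<omega>. L \<omega> s) \<in> measurable N (count_space UNIV)" for s
        unfolding L_def by (rule measurable_card_bounded_Collect) measurable
      have sub: "sampled (W \<omega>) k \<subseteq> {..<n}" if "\<omega> \<in> space N" for \<omega>
        using measurable_space[OF sk that] by (auto simp: server_samples_def)
      have mem: "Measurable.pred N (\<lambda>\<omega>. s \<in> sampled (W \<omega>) k)" for s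
        by (rule measurable_compose[OF sk]) simp
      have "(\<lambda>\<omega>. shortest (sampled (W \<omega>) k) (L \<omega>)) \<in> measurable N (count_space (Pow {..<n}))"
      proof (rule measurable_set_valued)
        show "shortest (sampled (W \<omega>) k) (L \<omega>) \<subseteq> {..<n}" if "\<omega> \<in> space N" for \<omega>
          using sub[OF that] by (auto simp: shortest_def)
        fix s
        \<comment> \<open>The comparison over a random set becomes a finite conjunction over the
          fixed set of all servers.\<close>
        have eq: "s \<in> shortest (sampled (W \<omega>) k) (L \<omega>) \<longleftrightarrow> s \<in> sampled (W \<omega>) k \<and>
             (\<forall>s'\<in>{..<n}. s' \<in> sampled (W \<omega>) k \<longrightarrow> L \<omega> s \<le> L \<omega> s')" if "\<omega> \<in> space N" for \<omega>
          using sub[OF that] unfolding shortest_def by blast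
        show "Measurable.pred N (\<lambda>\<omega>. s \<in> shortest (sampled (W \<omega>) k) (L \<omega>))"
          by (subst measurable_cong[OF eq], assumption)
            (intro pred_intros_finite pred_intros_logic finite_lessThan mem pred_le_nat L)
      qed simp
      then have "(\<lambda>\<omega>. pick (tie (W \<omega>) k) (shortest (sampled (W \<omega>) k) (L \<omega>)))
        \<in> measurable N (count_space UNIV)"
      \<comment> \<open>The set of minimisers takes finitely many values; for each fixed value only
        the tie variable is random.\<close>
      proof (rule measurable_compose_countable'[rotated])
        fix A
        show "(\<lambda>\<omega>. pick (tie (W \<omega>) k) A) \<in> measurable N (count_space UNIV)"
          unfolding pick_def using tie[of k] by measurable
      qed (simp add: countable_finite)
      then show ?thesis
        using False by (subst server_of.simps) (simp add: L_def[abs_def] k_def)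
    qed
    \<comment> \<open>The maximum over a random index set is rewritten over the fixed set
      \<open>{..j}\<close>. Excluded indices contribute the arrival time of \<open>j\<close>, which
      belongs to the original set, and index \<open>j\<close> is always excluded, so that value does
      occur.\<close>
    have "departure_time init (W \<omega>) j =
      Max ((\<lambda>m. if m < j \<and> server_of init (W \<omega>) m = server_of init (W \<omega>) j
        then departure_time init (W \<omega>) m else arrival_time init (W \<omega>) j) ` {..j}) + service (W \<omega>) j" for \<omega>
      by (subst departure_time.simps) (auto intro!: arg_cong[where f = Max])
    moreover have "(\<lambda>\<omega>. Max ((\<lambda>m. if m < j \<and> server_of init (W \<omega>) m = server_of init (W \<omega>) j
        then departure_time init (W \<omega>) m else arrival_time init (W \<omega>) j) ` {..j}) + service (W \<omega>) j)
        \<in> borel_measurable N"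
    proof (intro borel_measurable_add serv borel_measurable_Max)
      fix m
      show "(\<lambda>\<omega>. if m < j \<and> server_of init (W \<omega>) m = server_of init (W \<omega>) j
        then departure_time init (W \<omega>) m else arrival_time init (W \<omega>) j) \<in> borel_measurable N"
      proof (cases "m < j")
        case True
        have "{\<omega> \<in> space N. server_of init (W \<omega>) m = server_of init (W \<omega>) j} \<in> sets N"
          using pred_eq_nat[OF IHs[OF True] S] by (simp add: pred_def)
        then show ?thesis using True by (simp add: measurable_If)
      qed simp
    qed simp
    ultimately show ?case using S by simp
  qed
  then show "(\<lambda>\<omega>. server_of init (W \<omega>) j) \<in> measurable N (count_space UNIV)"
    and "(\<lambda>\<omega>. departure_time init (W \<omega>) j) \<in> borel_measurable N" by auto
qed

section \<open>Queue lengths and the event of reaching a given length\<close>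

text \<open>This form covers the value \<infinity> as well and expresses a length bound through
  finite sets of jobs, of which there are only countably many.\<close>

lemma ge_queue_length_iff:
  "enat i \<le> queue_length init w t s \<longleftrightarrow> (\<exists>J. finite J \<and> card J = i \<and> J \<subseteq> jobs_present init w t s)"
proof (cases "finite (jobs_present init w t s)")
  case True
  then show ?thesis
    by (auto simp: queue_length_def intro: card_mono obtain_subset_with_card_n)
next
  case False
  then show ?thesis
    using infinite_arbitrarily_large[OF False, of i] by (auto simp: queue_length_def)
qed

lemma occupancy_pos_iff:
  "0 < occupancy n init w i t \<longleftrightarrow> (\<exists>s<n. enat i \<le> queue_length init w t s)"
  by (auto simp: occupancy_def card_gt_0_iff zero_less_divide_iff)

text \<open>If \<open>i\<close> given jobs are ever simultaneously present in \<open>[0,T]\<close>, they are so at the last of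
  their arrival times; this removes the uncountable quantification over \<open>t\<close>.\<close>

lemma sets_reach_event:
  assumes inter: "\<And>k. (\<lambda>\<omega>. interarrival (W \<omega>) k) \<in> borel_measurable M"
    and serv: "\<And>k. (\<lambda>\<omega>. service (W \<omega>) k) \<in> borel_measurable M"
    and tie: "\<And>k. (\<lambda>\<omega>. tie (W \<omega>) k) \<in> borel_measurable M"
    and samp: "\<And>k. (\<lambda>\<omega>. sampled (W \<omega>) k) \<in> measurable M (count_space (server_samples n d))"
  shows "reach_event M n init W T i \<in> sets M"
proof -
  note [measurable] = measurable_arrival_time[where W = W, OF inter]
  have [measurable]: "(\<lambda>\<omega>. server_of init (W \<omega>) j) \<in> measurable M (count_space UNIV)"
    "(\<lambda>\<omega>. departure_time init (W \<omega>) j) \<in> borel_measurable M" for j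
    using measurable_server_of_departure_time[where W = W and K = "Suc j" and j = j and init = init,
        OF inter serv tie samp] by simp_all
  have present_iff: "(\<exists>t\<in>{0..T}. J \<subseteq> jobs_present init w t s) \<longleftrightarrow>
    0 \<le> T \<and> (\<forall>j\<in>J. server_of init w j = s \<and> arrival_time init w j \<le> T \<and> 0 < departure_time init w j \<and>
      (\<forall>j'\<in>J. arrival_time init w j' < departure_time init w j))" (is "?l \<longleftrightarrow> ?r")
    if "finite J" for J w s
  proof
    assume ?l
    then obtain t where t: "0 \<le> t" "t \<le> T" and J: "J \<subseteq> jobs_present init w t s" by auto
    have "server_of init w j = s \<and> arrival_time init w j \<le> t \<and> t < departure_time init w j"
      if "j \<in> J" for j
      using J that by (auto simp: jobs_present_def)
    then show ?r using t by (meson le_less_trans order_trans)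
  next
    assume r: ?r
    \<comment> \<open>The inserted 0 handles empty \<open>J\<close> and sample points with negative
      interarrival times; it is the reason for the conjunct
      \<open>0 < departure_time init w j\<close> on the right-hand side.\<close>
    define t where "t = Max (insert 0 (arrival_time init w ` J))"
    have "t \<in> {0..T}" "J \<subseteq> jobs_present init w t s"
      using r that by (auto simp: t_def jobs_present_def)
    then show ?l by blast
  qed
  have "reach_event M n init W T i = {\<omega> \<in> space M. \<exists>s\<in>{..<n}. \<exists>J\<in>{J. finite J \<and> card J = i}.
    0 \<le> T \<and> (\<forall>j\<in>J. server_of init (W \<omega>) j = s \<and> arrival_time init (W \<omega>) j \<le> T \<and>
      0 < departure_time init (W \<omega>) j \<and>
      (\<forall>j'\<in>J. arrival_time init (W \<omega>) j' < departure_time init (W \<omega>) j))}" (is "_ = {\<omega> \<in> space M. \<exists>s\<in>_. \<exists>J\<in>_. ?R' s J \<omega>}")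
    unfolding reach_event_def
  proof (rule Collect_cong, rule conj_cong[OF refl])
    fix \<omega>
    have "(\<exists>t\<in>{0..T}. 0 < occupancy n init (W \<omega>) i t) \<longleftrightarrow>
      (\<exists>s\<in>{..<n}. \<exists>J\<in>{J. finite J \<and> card J = i}. \<exists>t\<in>{0..T}. J \<subseteq> jobs_present init (W \<omega>) t s)"
      unfolding occupancy_pos_iff ge_queue_length_iff by blast
    also have "\<dots> \<longleftrightarrow> (\<exists>s\<in>{..<n}. \<exists>J\<in>{J. finite J \<and> card J = i}. ?R' s J \<omega>)"
      by (intro bex_cong refl present_iff) simp
    finally show "(\<exists>t\<in>{0..T}. 0 < occupancy n init (W \<omega>) i t) \<longleftrightarrow> (\<exists>s\<in>{..<n}. \<exists>J\<in>{J. finite J \<and> card J = i}. ?R' s J \<omega>)" .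
  qed
  also have "\<dots> \<in> sets M"
  proof -
    have "countable {J::nat set. finite J \<and> card J = i}"
      by (rule countable_subset[OF _ countable_Collect_finite]) auto
    then show ?thesis
    proof (intro sets.sets_Collect_finite_Ex[OF _ finite_lessThan] sets.sets_Collect_countable_Ex')
      fix s J assume "J \<in> {J::nat set. finite J \<and> card J = i}"
      then have "finite J" by simp
      then show "{\<omega> \<in> space M. ?R' s J \<omega>} \<in> sets M"
        unfolding pred_def[symmetric] by (intro pred_intros_logic pred_intros_finite) measurable
    qed
  qed
  finally show ?thesis .
qed

section \<open>A sample path that reaches length 3\<close>

lemma departure_time_ge: "arrival_time init w j + service w j \<le> departure_time init w j"
  by (subst departure_time.simps) (auto intro: Max_ge)

lemma server_of_initial: "j < length init \<Longrightarrow> server_of init w j = init ! j"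
  by (subst server_of.simps) simp

lemma pick_in:
  assumes "finite B" "B \<noteq> {}" "u \<in> {0..<1}"
  shows "pick u B \<in> B"
proof -
  have "0 < card B" using assms by (simp add: card_gt_0_iff)
  then have "u * real (card B) < 1 * real (card B)"
    using assms by (intro mult_strict_right_mono) auto
  then have "nat \<lfloor>u * real (card B)\<rfloor> < card B"
    using assms(3) by (simp add: nat_less_iff floor_less_iff)
  then have "pick u B \<in> set (sorted_list_of_set B)"
    unfolding pick_def by (intro nth_mem) (use assms in simp)
  then show ?thesis using assms by simp
qed

lemma server_of_in_sampled:
  assumes "length init \<le> j" "sampled w (j - length init) = B" "finite B" "B \<noteq> {}"
    and "tie w (j - length init) \<in> {0..<1}"
  shows "server_of init w j \<in> B"
proof -
  have ne: "shortest B len \<noteq> {}" for len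
    using ex_min_if_finite[of "len ` B"] assms(3,4) by (auto simp: shortest_def not_less)
  have "server_of init w j \<in> shortest B
    (\<lambda>s. card {m. m < j \<and> server_of init w m = s \<and> arrival_time init w j < departure_time init w m})"
    (is "_ \<in> ?S")
  proof -
    have "finite ?S" by (rule finite_subset[OF _ assms(3)]) (auto simp: shortest_def)
    then have "pick (tie w (j - length init)) ?S \<in> ?S" using ne assms(5) by (rule pick_in)
    then show ?thesis using assms(1,2) by (subst server_of.simps) simp
  qed
  then show ?thesis by (simp add: shortest_def)
qed

text \<open>Jobs count whether or not they have departed, so this set is determined by the routing
  of jobs \<open>0, ..., J - 1\<close>. Job \<open>J\<close> itself is excluded.\<close>

definition doubly_joined :: "nat \<Rightarrow> nat list \<Rightarrow> nat \<Rightarrow> jsq_input \<Rightarrow> nat set" where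
  "doubly_joined n init J w = {s. s < n \<and> 2 \<le> card {m. m < J \<and> server_of init w m = s}}"

text \<open>Pure counting, with no reference to time. The hypothesis \<open>last\<close> is an
  implication because the cardinality \<open>d\<close> is derived only under the assumption that no
  server receives three jobs; otherwise the conclusion already holds.\<close>

lemma triply_joined:
  assumes len: "length init = n" and init: "set init = {..<n}"
    and samp: "\<And>k. k \<le> d \<Longrightarrow> sampled w k \<in> server_samples n d" and "1 \<le> d"
    and tie: "\<And>k. k \<le> d \<Longrightarrow> tie w k \<in> {0..<1}"
    and last: "card (doubly_joined n init (n + d) w) = d \<Longrightarrow> sampled w d = doubly_joined n init (n + d) w"
  shows "\<exists>s<n. 3 \<le> card {m. m \<le> n + d \<and> server_of init w m = s}"
proof (rule ccontr)
  assume not: "\<not> ?thesis"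
  have less: "card {m. m \<le> n + d \<and> server_of init w m = s} \<le> 2" if "s < n" for s
  proof -
    have "\<not> 3 \<le> card {m. m \<le> n + d \<and> server_of init w m = s}"
      using not that by blast
    then show ?thesis by simp
  qed
  define L where "L s = card {m. m < n + d \<and> server_of init w m = s}" for s
  have Lle: "L s \<le> 2" if "s < n" for s
  proof -
    have "L s \<le> card {m. m \<le> n + d \<and> server_of init w m = s}"
      unfolding L_def by (rule card_mono) auto
    then show ?thesis using less[OF that] by simp
  qed
  have srv: "server_of init w m \<in> sampled w (m - n)" if "n \<le> m" "m \<le> n + d" for m
  proof -
    have "sampled w (m - n) \<in> server_samples n d" using that by (intro samp) auto
    then have "finite (sampled w (m - n))" "sampled w (m - n) \<noteq> {}"
      using \<open>1 \<le> d\<close> by (auto simp: server_samples_def intro: finite_subset)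
    then show ?thesis
      using that len tie[of "m - n"] by (intro server_of_in_sampled) auto
  qed
  have srvn: "server_of init w m < n" if "m \<le> n + d" for m
  proof (cases "m < n")
    case True
    then have "init ! m \<in> {..<n}" using init len nth_mem[of m init] by auto
    then show ?thesis using True len by (simp add: server_of_initial)
  next
    case False
    then have "sampled w (m - n) \<in> server_samples n d" using that by (intro samp) auto
    then show ?thesis using srv[of m] False that by (auto simp: server_samples_def)
  qed
  have Lge: "1 \<le> L s" if "s < n" for s
  proof -
    have "s \<in> set init" using that init by simp
    then obtain m where "m < n" "init ! m = s"
      unfolding in_set_conv_nth len by blast
    then have "m \<in> {m. m < n + d \<and> server_of init w m = s}"
      using len by (simp add: server_of_initial)
    then have "0 < L s" unfolding L_def by (subst card_gt_0_iff) auto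
    then show ?thesis by simp
  qed
  have "n + d = card (\<Union>s\<in>{..<n}. {m. m < n + d \<and> server_of init w m = s})"
  proof -
    have "(\<Union>s\<in>{..<n}. {m. m < n + d \<and> server_of init w m = s}) = {..<n + d}"
      using srvn by auto
    then show ?thesis by simp
  qed
  also have "\<dots> = (\<Sum>s<n. L s)"
    unfolding L_def by (intro card_UN_disjoint) auto
  \<comment> \<open>Every server has its initial job and at most one more, so the excess of the
    total over \<open>n\<close> is the number of servers with two jobs. Comparison with
    \<open>n + d\<close> gives exactly \<open>d\<close> of them.\<close>
  also have "\<dots> = (\<Sum>s<n. 1 + (if 2 \<le> L s then 1 else 0))"
  proof (rule sum.cong[OF refl])
    fix s assume "s \<in> {..<n}"
    then show "L s = 1 + (if 2 \<le> L s then 1 else 0)" using Lle[of s] Lge[of s] by auto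
  qed
  also have "\<dots> = n + card {s \<in> {..<n}. 2 \<le> L s}"
    unfolding sum.distrib by (simp add: sum.If_cases Int_def)
  also have "{s \<in> {..<n}. 2 \<le> L s} = doubly_joined n init (n + d) w"
    by (auto simp: doubly_joined_def L_def)
  finally have "card (doubly_joined n init (n + d) w) = d" by simp
  then have "server_of init w (n + d) \<in> doubly_joined n init (n + d) w"
    using srv[of "n + d"] last by simp
  then obtain s where s: "server_of init w (n + d) = s" "s < n" "2 \<le> L s"
    by (auto simp: doubly_joined_def L_def)
  have "{m. m \<le> n + d \<and> server_of init w m = s} = insert (n + d) {m. m < n + d \<and> server_of init w m = s}"
    using s(1) by auto
  then have "card {m. m \<le> n + d \<and> server_of init w m = s} = Suc (L s)"
    by (simp add: L_def)
  then show False using less[OF s(2)] s(3) by simp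
qed

text \<open>Gaps of at most \<open>\<delta> / (d + 1)\<close> bring job \<open>n + d\<close>, the
  arrival with index \<open>d\<close>, in by time \<open>\<delta>\<close>. Service times above
  \<open>\<delta>\<close> retain all jobs until then, so the jobs that joined a server are still
  there.\<close>

lemma occupancy_3_pos:
  assumes len: "length init = n" and init: "set init = {..<n}" and "1 \<le> d"
    and samp: "\<And>k. k \<le> d \<Longrightarrow> sampled w k \<in> server_samples n d"
    and tie: "\<And>k. k \<le> d \<Longrightarrow> tie w k \<in> {0..<1}"
    and last: "card (doubly_joined n init (n + d) w) = d \<Longrightarrow> sampled w d = doubly_joined n init (n + d) w"
    and inter: "\<And>k. k \<le> d \<Longrightarrow> 0 \<le> interarrival w k \<and> interarrival w k \<le> \<delta> / real (Suc d)"
    and serv: "\<And>j. j \<le> n + d \<Longrightarrow> \<delta> < service w j"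
  shows "\<exists>t\<in>{0..\<delta>}. 0 < occupancy n init w 3 t"
proof -
  define t where "t = arrival_time init w (n + d)"
  have t: "t = (\<Sum>k\<le>d. interarrival w k)" by (simp add: t_def arrival_time_def len)
  have "(\<Sum>k\<le>d. interarrival w k) \<le> (\<Sum>k\<le>d. \<delta> / real (Suc d))"
    using inter by (intro sum_mono) auto
  also have "\<dots> = \<delta>" by (simp add: field_simps)
  finally have "t \<le> \<delta>" by (simp add: t)
  have arr: "0 \<le> arrival_time init w m \<and> arrival_time init w m \<le> t" if "m \<le> n + d" for m
  proof -
    have "m - n \<le> d" using that by auto
    then have "(\<Sum>k\<le>m - n. interarrival w k) \<le> t" "0 \<le> (\<Sum>k\<le>m - n. interarrival w k)" "0 \<le> t"
      unfolding t using inter by (auto intro!: sum_mono2 sum_nonneg)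
    then show ?thesis by (simp add: arrival_time_def len)
  qed
  have "0 \<le> t" using arr[of "n + d"] by simp
  obtain s where s: "s < n" "3 \<le> card {m. m \<le> n + d \<and> server_of init w m = s}"
    using triply_joined[where w = w, OF len init samp \<open>1 \<le> d\<close> tie last] by auto
  obtain J where J: "J \<subseteq> {m. m \<le> n + d \<and> server_of init w m = s}" "card J = 3"
    using obtain_subset_with_card_n[OF s(2)] by metis
  have "J \<subseteq> jobs_present init w t s"
  proof
    fix j assume "j \<in> J"
    then have j: "j \<le> n + d" "server_of init w j = s" using J by auto
    \<comment> \<open>Waiting can only delay a departure: it is at least arrival plus service, which
      exceeds \<open>0 + \<delta>\<close>.\<close>
    have "t < departure_time init w j"
      using departure_time_ge[of init w j] arr[OF j(1)] serv[OF j(1)] \<open>t \<le> \<delta>\<close> by linarith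
    then show "j \<in> jobs_present init w t s"
      using j arr[OF j(1)] by (simp add: jobs_present_def)
  qed
  moreover have "finite J" using J(2) by (simp add: card_ge_0_finite)
  ultimately have "enat 3 \<le> queue_length init w t s"
    using J(2) ge_queue_length_iff by blast
  then show ?thesis
    using s(1) \<open>0 \<le> t\<close> \<open>t \<le> \<delta>\<close> occupancy_pos_iff by (intro bexI[of _ t]) auto
qed

section \<open>The initial configuration\<close>

text \<open>Positive gaps and services make the jobs present at time 0 exactly the initial ones.
  Then full occupancy at level 1 gives each server at least one, and zero occupancy at level 2 gives
  it at most one.\<close>

lemma initial_jobs_of_occupancy:
  assumes init: "set init \<subseteq> {..<n}" and "1 \<le> n"
    and serv: "\<And>j. 0 < service w j" and inter: "\<And>k. 0 < interarrival w k"
    and occ: "\<And>i. 1 \<le> i \<Longrightarrow> occupancy n init w i 0 = (if i = 1 then 1 else 0)"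
  shows "length init = n" "set init = {..<n}"
proof -
  have present: "jobs_present init w 0 s = {j. j < length init \<and> init ! j = s}" for s
  proof -
    have "0 < arrival_time init w j" if "\<not> j < length init" for j
      using that inter by (auto simp: arrival_time_def intro!: sum_pos)
    moreover have "arrival_time init w j = 0 \<and> server_of init w j = init ! j" if "j < length init" for j
      using that by (simp add: server_of_initial arrival_time_def)
    moreover have "0 < departure_time init w j" if "j < length init" for j
      using departure_time_ge[of init w j] serv[of j] that by (simp add: arrival_time_def)
    ultimately show ?thesis
      unfolding jobs_present_def by (metis (mono_tags, lifting) less_eq_real_def not_less)
  qed
  have ql: "queue_length init w 0 s = enat (card {j. j < length init \<and> init ! j = s})" for s
    by (simp add: queue_length_def present)
  have "card {s. s < n \<and> 1 \<le> queue_length init w 0 s} = n"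
    using occ[of 1] \<open>1 \<le> n\<close> by (simp add: occupancy_def field_simps one_enat_def)
  then have "{s. s < n \<and> 1 \<le> queue_length init w 0 s} = {..<n}"
    by (intro card_subset_eq) auto
  then have ge1: "1 \<le> card {j. j < length init \<and> init ! j = s}" if "s < n" for s
    using that by (auto simp: ql one_enat_def)
  have "\<not> 0 < occupancy n init w 2 0" using occ[of 2] by simp
  then have le1: "card {j. j < length init \<and> init ! j = s} \<le> 1" if "s < n" for s
    using that unfolding occupancy_pos_iff ql by (force simp: not_le)
  show set: "set init = {..<n}"
  proof
    show "{..<n} \<subseteq> set init"
    proof
      fix s assume "s \<in> {..<n}"
      then have "{j. j < length init \<and> init ! j = s} \<noteq> {}" using ge1[of s] by force
      then show "s \<in> set init" by auto
    qed
  qed fact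
  have "{..<length init} = (\<Union>s\<in>{..<n}. {j. j < length init \<and> init ! j = s})"
    using init nth_mem by fastforce
  then have "length init = card (\<Union>s\<in>{..<n}. {j. j < length init \<and> init ! j = s})"
    by (metis card_lessThan)
  also have "\<dots> = (\<Sum>s<n. card {j. j < length init \<and> init ! j = s})"
    by (intro card_UN_disjoint) auto
  also have "\<dots> = (\<Sum>s<n. 1)"
    using ge1 le1 by (intro sum.cong) (auto intro: antisym)
  finally show "length init = n" by simp
qed

section \<open>The probability of such paths\<close>

text \<open>Routing the first \<open>K\<close> arrivals consults the samples with index below
  \<open>K\<close> only; hence the set is measurable without knowledge of sample
  \<open>K\<close>.\<close>

lemma measurable_doubly_joined:
  assumes "\<And>k. (\<lambda>\<omega>. interarrival (W \<omega>) k) \<in> borel_measurable N"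
    and "\<And>k. (\<lambda>\<omega>. service (W \<omega>) k) \<in> borel_measurable N"
    and "\<And>k. (\<lambda>\<omega>. tie (W \<omega>) k) \<in> borel_measurable N"
    and "\<And>k. k < K \<Longrightarrow> (\<lambda>\<omega>. sampled (W \<omega>) k) \<in> measurable N (count_space (server_samples n d))"
  shows "(\<lambda>\<omega>. doubly_joined n init (length init + K) (W \<omega>)) \<in> measurable N (count_space (Pow {..<n}))"
proof (rule measurable_set_valued)
  fix s assume s: "s \<in> {..<n}"
  have two: "(\<lambda>_. 2::nat) \<in> measurable N (count_space UNIV)" by (rule measurable_const) simp
  have "(\<lambda>\<omega>. card {m. m < length init + K \<and> server_of init (W \<omega>) m = s}) \<in> measurable N (count_space UNIV)"
  proof (rule measurable_card_bounded_Collect)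
    fix m assume "m < length init + K"
    note measurable_server_of_departure_time(1)[where W = W and N = N, OF assms this]
    then show "Measurable.pred N (\<lambda>\<omega>. server_of init (W \<omega>) m = s)"
      by (rule pred_eq_nat[OF _ measurable_const]) simp_all
  qed
  from pred_le_nat[OF two this]
  have "Measurable.pred N (\<lambda>\<omega>. 2 \<le> card {m. m < length init + K \<and> server_of init (W \<omega>) m = s})" .
  moreover have "s \<in> doubly_joined n init (length init + K) w \<longleftrightarrow>
      2 \<le> card {m. m < length init + K \<and> server_of init w m = s}" for w
    using s by (simp add: doubly_joined_def)
  ultimately show "Measurable.pred N (\<lambda>\<omega>. s \<in> doubly_joined n init (length init + K) (W \<omega>))"
    by (simp only:)
qed (auto simp: doubly_joined_def)

lemma card_server_samples: "card (server_samples n d) = n choose d"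
  using n_subsets[of "{..<n}" d] by (simp add: server_samples_def)

lemma finite_server_samples: "finite (server_samples n d)"
  by (rule finite_subset[of _ "Pow {..<n}"]) (auto simp: server_samples_def)

lemma Int_stable_vimage: "Int_stable {f -` B \<inter> S |B. B \<in> sets N}"
proof (rule Int_stableI, clarify)
  fix A B assume "A \<in> sets N" "B \<in> sets N"
  then show "\<exists>C. (f -` A \<inter> S) \<inter> (f -` B \<inter> S) = f -` C \<inter> S \<and> C \<in> sets N"
    by (intro exI[of _ "A \<inter> B"]) auto
qed

section \<open>Independence of one sampled set from all other primitives\<close>

context jsq_system
begin

lemma Int_stable_primitive_events: "Int_stable (primitive_events M n d W p)"
  by (cases p) (simp_all only: primitive_events.simps Int_stable_vimage)

lemma prob_sampled:
  assumes "B \<in> server_samples n d"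
  shows "prob {\<omega> \<in> space M. sampled (W \<omega>) k = B} = 1 / real (n choose d)"
proof -
  have "prob {\<omega> \<in> space M. sampled (W \<omega>) k = B} =
    measure (distr M (count_space (server_samples n d)) (\<lambda>\<omega>. sampled (W \<omega>) k)) {B}"
    using assms sampled_measurable by (subst measure_distr) (auto intro: arg_cong[where f = prob])
  also have "\<dots> = 1 / real (n choose d)"
    using assms finite_server_samples
    by (simp add: sampled_dist measure_uniform_count_measure card_server_samples)
  finally show ?thesis .
qed

text \<open>The information in all primitives except the sample of arrival \<open>k\<close>. It
  replaces conditioning: events here are independent of that sample.\<close>

definition others :: "nat \<Rightarrow> 'a measure" where
  "others k = sigma (space M) (\<Union>p\<in>UNIV - {Sampled k}. primitive_events M n d W p)"

lemma primitive_events_subset: "primitive_events M n d W p \<subseteq> events"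
  using primitives_independent by (auto simp: indep_sets_def)

lemma space_others [simp]: "space (others k) = space M"
  and sets_others: "sets (others k) = sigma_sets (space M) (\<Union>p\<in>UNIV - {Sampled k}. primitive_events M n d W p)"
proof -
  have "(\<Union>p\<in>UNIV - {Sampled k}. primitive_events M n d W p) \<subseteq> Pow (space M)"
    using primitive_events_subset sets.space_closed by blast
  then show "space (others k) = space M"
    "sets (others k) = sigma_sets (space M) (\<Union>p\<in>UNIV - {Sampled k}. primitive_events M n d W p)"
    by (simp_all add: others_def)
qed

lemma in_sets_others: "p \<noteq> Sampled k \<Longrightarrow> A \<in> primitive_events M n d W p \<Longrightarrow> A \<in> sets (others k)"
  unfolding sets_others by (rule sigma_sets.Basic) auto

lemma measurable_others:
  "(\<lambda>\<omega>. interarrival (W \<omega>) j) \<in> borel_measurable (others k)"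
  "(\<lambda>\<omega>. service (W \<omega>) j) \<in> borel_measurable (others k)"
  "(\<lambda>\<omega>. tie (W \<omega>) j) \<in> borel_measurable (others k)"
  "j \<noteq> k \<Longrightarrow> (\<lambda>\<omega>. sampled (W \<omega>) j) \<in> measurable (others k) (count_space (server_samples n d))"
proof -
  show "(\<lambda>\<omega>. interarrival (W \<omega>) j) \<in> borel_measurable (others k)"
    by (rule measurableI, simp, rule in_sets_others[of "Interarrival j"]) auto
  show "(\<lambda>\<omega>. service (W \<omega>) j) \<in> borel_measurable (others k)"
    by (rule measurableI, simp, rule in_sets_others[of "Service j"]) auto
  show "(\<lambda>\<omega>. tie (W \<omega>) j) \<in> borel_measurable (others k)"
    by (rule measurableI, simp, rule in_sets_others[of "Tie j"]) auto
  show "(\<lambda>\<omega>. sampled (W \<omega>) j) \<in> measurable (others k) (count_space (server_samples n d))" if "j \<noteq> k"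
  proof (rule measurableI)
    show "sampled (W \<omega>) j \<in> space (count_space (server_samples n d))" if "\<omega> \<in> space (others k)" for \<omega>
      using measurable_space[OF sampled_measurable] that by simp
  qed (rule in_sets_others[of "Sampled j"], use that in auto)
qed

lemma sets_others_subset: "sets (others k) \<subseteq> events"
  unfolding sets_others using primitive_events_subset by (intro sets.sigma_sets_subset) blast

text \<open>Mutual independence is grouped into two blocks, the single sample and everything else.
  Intersection stability of the generators carries it over to the generated sigma-algebras.\<close>

lemma prob_others_Int_sampled:
  assumes A: "A \<in> sets (others k)" and B: "B \<in> server_samples n d"
  shows "prob (A \<inter> {\<omega> \<in> space M. sampled (W \<omega>) k = B}) = prob A / real (n choose d)"
proof -
  define I where "I b = (if b then UNIV - {Sampled k} else {Sampled k})" for b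
  have "indep_sets (primitive_events M n d W) (\<Union>b\<in>UNIV. I b)"
    by (rule indep_sets_mono_index[OF _ primitives_independent]) simp
  then have indep: "indep_sets (\<lambda>b. sigma_sets (space M) (\<Union>p\<in>I b. primitive_events M n d W p)) UNIV"
    by (rule indep_sets_collect_sigma)
      (auto simp: disjoint_family_on_def I_def intro: Int_stable_primitive_events)
  define S where "S = {\<omega> \<in> space M. sampled (W \<omega>) k = B}"
  have "S = (\<lambda>\<omega>. sampled (W \<omega>) k) -` {B} \<inter> space M" by (auto simp: S_def)
  then have "S \<in> primitive_events M n d W (Sampled k)" using B by auto
  then have S: "S \<in> sigma_sets (space M) (\<Union>p\<in>I False. primitive_events M n d W p)"
    by (intro sigma_sets.Basic) (simp add: I_def)
  have A': "A \<in> sigma_sets (space M) (\<Union>p\<in>I True. primitive_events M n d W p)"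
    using A by (simp add: sets_others I_def)
  have "prob (\<Inter>b\<in>UNIV. if b then A else S) = (\<Prod>b\<in>UNIV. prob (if b then A else S))"
    using S A' by (intro indep_setsD[OF indep]) auto
  then have "prob (A \<inter> S) = prob A * prob S" by (simp add: UNIV_bool Int_commute mult.commute)
  then show ?thesis using prob_sampled[OF B] by (simp add: S_def)
qed

text \<open>A uniform sample independent of a random target hits it with the same probability
  whatever the target is. Splitting by the finitely many values of \<open>F\<close> reduces this to
  a fixed target.\<close>

lemma prob_sampled_eq_random:
  assumes A: "A \<in> sets (others k)"
    and F: "F \<in> measurable (others k) (count_space (server_samples n d))"
  shows "A \<inter> {\<omega> \<in> space M. sampled (W \<omega>) k = F \<omega>} \<in> events"
    and "prob (A \<inter> {\<omega> \<in> space M. sampled (W \<omega>) k = F \<omega>}) = prob A / real (n choose d)"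
proof -
  let ?S = "server_samples n d"
  define S where "S B = {\<omega> \<in> space M. sampled (W \<omega>) k = B}" for B
  define AF where "AF B = A \<inter> {\<omega> \<in> space M. F \<omega> = B}" for B
  have Fsp: "F \<omega> \<in> ?S" if "\<omega> \<in> space M" for \<omega> using measurable_space[OF F] that by simp
  have "A \<subseteq> space M" using A sets.sets_into_space by fastforce
  have AF: "AF B \<in> sets (others k)" if "B \<in> ?S" for B
  proof -
    have "F -` {B} \<inter> space (others k) \<in> sets (others k)"
      using F that by (intro measurable_sets) auto
    then have "A \<inter> (F -` {B} \<inter> space (others k)) \<in> sets (others k)" using A by auto
    then show ?thesis by (simp add: AF_def Int_def vimage_def conj_commute)
  qed
  have S: "S B \<in> events" if "B \<in> ?S" for B
  proof -
    have "(\<lambda>\<omega>. sampled (W \<omega>) k) -` {B} \<inter> space M \<in> events"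
      using sampled_measurable that by (intro measurable_sets) auto
    then show ?thesis by (simp add: S_def Int_def vimage_def conj_commute)
  qed
  have ev: "(\<lambda>B. AF B \<inter> S B) ` ?S \<subseteq> events" using AF S sets_others_subset by blast
  have eq: "A \<inter> {\<omega> \<in> space M. sampled (W \<omega>) k = F \<omega>} = (\<Union>B\<in>?S. AF B \<inter> S B)"
    using Fsp by (auto simp: AF_def S_def)
  show "A \<inter> {\<omega> \<in> space M. sampled (W \<omega>) k = F \<omega>} \<in> events"
    unfolding eq using ev finite_server_samples by blast
  have "prob (A \<inter> {\<omega> \<in> space M. sampled (W \<omega>) k = F \<omega>}) = (\<Sum>B\<in>?S. prob (AF B \<inter> S B))"
    unfolding eq
    by (intro finite_measure_finite_Union finite_server_samples ev) (auto simp: disjoint_family_on_def AF_def)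
  also have "\<dots> = (\<Sum>B\<in>?S. prob (AF B) / real (n choose d))"
    using prob_others_Int_sampled AF by (intro sum.cong) (auto simp: S_def)
  also have "\<dots> = (\<Sum>B\<in>?S. prob (AF B)) / real (n choose d)" by (simp add: sum_divide_distrib)
  also have "(\<Sum>B\<in>?S. prob (AF B)) = prob (\<Union>B\<in>?S. AF B)"
    using AF sets_others_subset
    by (intro finite_measure_finite_Union[symmetric] finite_server_samples)
      (auto simp: disjoint_family_on_def AF_def)
  also have "(\<Union>B\<in>?S. AF B) = A"
    using Fsp \<open>A \<subseteq> space M\<close> by (auto simp: AF_def)
  finally show "prob (A \<inter> {\<omega> \<in> space M. sampled (W \<omega>) k = F \<omega>}) = prob A / real (n choose d)" .
qed

section \<open>Probabilities of early arrivals and late departures\<close>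

text \<open>Positivity of the gap is included for the pathwise argument; it holds almost surely and
  leaves the exponential distribution function unchanged.\<close>

lemma prob_interarrival_le:
  assumes "0 \<le> a"
  shows "prob {\<omega> \<in> space M. 0 < interarrival (W \<omega>) k \<and> interarrival (W \<omega>) k \<le> a}
    = 1 - exp (- a * (real n * lam))"
proof -
  have [measurable]: "(\<lambda>\<omega>. interarrival (W \<omega>) k) \<in> borel_measurable M"
    using distributed_measurable[OF interarrival_dist[of k]] by simp
  have l: "0 < real n * lam" using servers rate_pos by simp
  have "prob {\<omega> \<in> space M. 0 < interarrival (W \<omega>) k \<and> interarrival (W \<omega>) k \<le> a} =
    prob ({\<omega> \<in> space M. 0 < interarrival (W \<omega>) k} - {\<omega> \<in> space M. a < interarrival (W \<omega>) k})"
    by (rule arg_cong[where f = prob]) auto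
  also have "\<dots> = \<P>(\<omega> in M. 0 < interarrival (W \<omega>) k) - \<P>(\<omega> in M. a < interarrival (W \<omega>) k)"
    using assms by (intro finite_measure_Diff) auto
  also have "\<dots> = 1 - exp (- a * (real n * lam))"
    using assms l by (simp add: exponential_distributedD_gt[OF interarrival_dist])
  finally show ?thesis .
qed

lemma prob_service_gt: "0 \<le> a \<Longrightarrow> prob {\<omega> \<in> space M. a < service (W \<omega>) k} = exp (- a)"
  using exponential_distributedD_gt[OF service_dist] by simp

lemma prob_tie: "prob {\<omega> \<in> space M. tie (W \<omega>) k \<in> {0..<1}} = 1"
proof -
  have "prob {\<omega> \<in> space M. tie (W \<omega>) k \<in> {0..<1}} = measure (distr M lborel (\<lambda>\<omega>. tie (W \<omega>) k)) {0..<1}"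
    using tie_measurable by (subst measure_distr) (auto intro!: arg_cong[where f = prob])
  also have "\<dots> = 1" by (simp add: tie_dist measure_uniform_measure)
  finally show ?thesis .
qed

text \<open>\<open>G\<close> involves no sampled set, so it lies in \<open>others k\<close> for
  every \<open>k\<close>. Independence turns its probability into a product over
  \<open>d + 1\<close> gaps, \<open>n + d + 1\<close> services, and ties of probability one.\<close>

lemma prob_early_arrivals_late_departures:
  assumes "0 \<le> \<delta>"
  defines "G \<equiv> {\<omega> \<in> space M.
    (\<forall>k\<le>d. 0 < interarrival (W \<omega>) k \<and> interarrival (W \<omega>) k \<le> \<delta> / real (Suc d)) \<and>
    (\<forall>j\<le>n + d. \<delta> < service (W \<omega>) j) \<and> (\<forall>k\<le>d. tie (W \<omega>) k \<in> {0..<1})}"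
  shows "G \<in> sets (others k)"
    and "prob G = (1 - exp (- \<delta> * (real n * lam) / real (Suc d))) ^ Suc d * exp (- \<delta>) ^ Suc (n + d)"
proof -
  note [measurable] = measurable_others
  have "G = {\<omega> \<in> space (others k).
    (\<forall>k\<in>{..d}. 0 < interarrival (W \<omega>) k \<and> interarrival (W \<omega>) k \<le> \<delta> / real (Suc d)) \<and>
    (\<forall>j\<in>{..n + d}. \<delta> < service (W \<omega>) j) \<and> (\<forall>k\<in>{..d}. tie (W \<omega>) k \<in> {0..<1})}"
    by (auto simp: G_def)
  also have "\<dots> \<in> sets (others k)" by measurable
  finally show "G \<in> sets (others k)" .
  \<comment> \<open>The value for \<open>Sampled\<close> is a filler: \<open>J\<close> below
    contains no such index.\<close>
  define A where "A p = (case p of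
      Interarrival k \<Rightarrow> {\<omega> \<in> space M. 0 < interarrival (W \<omega>) k \<and> interarrival (W \<omega>) k \<le> \<delta> / real (Suc d)}
    | Service k \<Rightarrow> {\<omega> \<in> space M. \<delta> < service (W \<omega>) k}
    | Tie k \<Rightarrow> {\<omega> \<in> space M. tie (W \<omega>) k \<in> {0..<1}}
    | Sampled k \<Rightarrow> space M)" for p
  define J where "J = Interarrival ` {..d} \<union> Service ` {..n + d} \<union> Tie ` {..d}"
  have A: "A (Interarrival k) = (\<lambda>\<omega>. interarrival (W \<omega>) k) -` {0<..\<delta> / real (Suc d)} \<inter> space M"
    "A (Service k) = (\<lambda>\<omega>. service (W \<omega>) k) -` {\<delta><..} \<inter> space M"
    "A (Tie k) = (\<lambda>\<omega>. tie (W \<omega>) k) -` {0..<1} \<inter> space M" for k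
    by (auto simp: A_def)
  have "G = (\<Inter>p\<in>J. A p)"
  proof (intro antisym subsetI)
    fix \<omega> assume "\<omega> \<in> G"
    then show "\<omega> \<in> (\<Inter>p\<in>J. A p)" by (auto simp: G_def J_def A_def)
  next
    fix \<omega> assume \<omega>: "\<omega> \<in> (\<Inter>p\<in>J. A p)"
    have "\<omega> \<in> A (Interarrival k)" "\<omega> \<in> A (Tie k)" if "k \<le> d" for k
      using \<omega> that by (auto simp: J_def)
    moreover have "\<omega> \<in> A (Service k)" if "k \<le> n + d" for k
      using \<omega> that by (auto simp: J_def)
    ultimately show "\<omega> \<in> G" unfolding G_def A_def by fastforce
  qed
  also have "prob \<dots> = (\<Prod>p\<in>J. prob (A p))"
  proof (rule indep_setsD[OF primitives_independent])
    have "A (Interarrival k) \<in> primitive_events M n d W (Interarrival k)"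
      "A (Service k) \<in> primitive_events M n d W (Service k)"
      "A (Tie k) \<in> primitive_events M n d W (Tie k)" for k
      unfolding A primitive_events.simps by (intro CollectI exI conjI, rule refl, simp)+
    then show "\<forall>p\<in>J. A p \<in> primitive_events M n d W p"
      unfolding J_def by blast
  qed (auto simp: J_def)
  also have "\<dots> = (\<Prod>k\<le>d. prob (A (Interarrival k))) * (\<Prod>k\<le>n + d. prob (A (Service k)))
    * (\<Prod>k\<le>d. prob (A (Tie k)))"
  proof -
    have "(\<Prod>p\<in>J. prob (A p)) = (\<Prod>p\<in>Interarrival ` {..d} \<union> Service ` {..n + d}. prob (A p))
        * (\<Prod>p\<in>Tie ` {..d}. prob (A p))"
      unfolding J_def by (rule prod.union_disjoint) auto
    also have "(\<Prod>p\<in>Interarrival ` {..d} \<union> Service ` {..n + d}. prob (A p)) =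
        (\<Prod>p\<in>Interarrival ` {..d}. prob (A p)) * (\<Prod>p\<in>Service ` {..n + d}. prob (A p))"
      by (rule prod.union_disjoint) auto
    finally show ?thesis by (simp add: prod.reindex inj_on_def)
  qed
  also have "(\<lambda>k. prob (A (Interarrival k))) = (\<lambda>_. 1 - exp (- \<delta> * (real n * lam) / real (Suc d)))"
    using prob_interarrival_le[of "\<delta> / real (Suc d)"] assms(1) by (simp add: A_def)
  also have "(\<lambda>k. prob (A (Service k))) = (\<lambda>_. exp (- \<delta>))"
    using prob_service_gt assms(1) by (simp add: A_def)
  also have "(\<lambda>k. prob (A (Tie k))) = (\<lambda>_. 1)"
    using prob_tie by (simp add: A_def)
  also have "(\<Prod>k\<le>d. 1 - exp (- \<delta> * (real n * lam) / real (Suc d))) * (\<Prod>k\<le>n + d. exp (- \<delta>))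
      * (\<Prod>k\<le>d. 1) = (1 - exp (- \<delta> * (real n * lam) / real (Suc d))) ^ Suc d * exp (- \<delta>) ^ Suc (n + d)"
    by simp
  finally show "prob G = (1 - exp (- \<delta> * (real n * lam) / real (Suc d))) ^ Suc d * exp (- \<delta>) ^ Suc (n + d)" .
qed

section \<open>The lower bound for a fixed number of servers\<close>

text \<open>The list \<open>init\<close> is deterministic, so a single sample point satisfying the
  almost sure conditions determines its length and its servers.\<close>

lemma initial_jobs:
  assumes "AE \<omega> in M. \<forall>i\<ge>1. occupancy n init (W \<omega>) i 0 = (if i = 1 then 1 else 0)"
  shows "length init = n" "set init = {..<n}"
proof -
  have l: "0 < real n * lam" using servers rate_pos by simp
  have [measurable]: "(\<lambda>\<omega>. interarrival (W \<omega>) k) \<in> borel_measurable M"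
    "(\<lambda>\<omega>. service (W \<omega>) k) \<in> borel_measurable M" for k
    using distributed_measurable[OF interarrival_dist[of k]] distributed_measurable[OF service_dist[of k]]
    by simp_all
  have "AE \<omega> in M. 0 < interarrival (W \<omega>) k" for k
    by (subst prob_Collect_eq_1[symmetric]) (simp_all add: exponential_distributedD_gt[OF interarrival_dist _ l])
  moreover have "AE \<omega> in M. 0 < service (W \<omega>) k" for k
    by (subst prob_Collect_eq_1[symmetric]) (simp_all add: prob_service_gt)
  ultimately have "AE \<omega> in M. \<forall>k. 0 < interarrival (W \<omega>) k \<and> 0 < service (W \<omega>) k"
    unfolding AE_all_countable by auto
  then have "AE \<omega> in M. (\<forall>k. 0 < interarrival (W \<omega>) k \<and> 0 < service (W \<omega>) k) \<and>
    (\<forall>i\<ge>1. occupancy n init (W \<omega>) i 0 = (if i = 1 then 1 else 0))"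
    using assms by eventually_elim blast
  from eventually_happens[OF this] obtain \<omega> where "\<forall>k. 0 < interarrival (W \<omega>) k \<and> 0 < service (W \<omega>) k"
    "\<forall>i\<ge>1. occupancy n init (W \<omega>) i 0 = (if i = 1 then 1 else 0)"
    by (auto simp: trivial_limit_def)
  then show "length init = n" "set init = {..<n}"
    using initial_jobs_of_occupancy[of init n "W \<omega>"] initial_servers servers by auto
qed

lemma reach_event_measurable: "reach_event M n init W T i \<in> events"
  using distributed_measurable[OF interarrival_dist] distributed_measurable[OF service_dist]
  by (intro sets_reach_event[where d = d] tie_measurable sampled_measurable) simp_all

lemma prob_reach_event_3_ge:
  assumes occ: "AE \<omega> in M. \<forall>i\<ge>1. occupancy n init (W \<omega>) i 0 = (if i = 1 then 1 else 0)"
    and \<delta>: "0 \<le> \<delta>" "\<delta> \<le> T"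
  shows "(1 - exp (- \<delta> * (real n * lam) / real (Suc d))) ^ Suc d * exp (- \<delta>) ^ Suc (n + d)
      / real (n choose d) \<le> prob (reach_event M n init W T 3)"
proof -
  note init = initial_jobs[OF occ]
  define G where "G = {\<omega> \<in> space M.
    (\<forall>k\<le>d. 0 < interarrival (W \<omega>) k \<and> interarrival (W \<omega>) k \<le> \<delta> / real (Suc d)) \<and>
    (\<forall>j\<le>n + d. \<delta> < service (W \<omega>) j) \<and> (\<forall>k\<le>d. tie (W \<omega>) k \<in> {0..<1})}"
  \<comment> \<open>The default \<open>{..<d}\<close> makes \<open>F\<close> a legitimate sample
    everywhere. It is taken only when the cardinality is not \<open>d\<close>, where the premise of
    \<open>last\<close> in \<open>occupancy_3_pos\<close> fails.\<close>
  define F where "F \<omega> = (let B = doubly_joined n init (n + d) (W \<omega>) in if card B = d then B else {..<d})" for \<omega>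
  have "(\<lambda>\<omega>. doubly_joined n init (length init + d) (W \<omega>))
    \<in> measurable (others d) (count_space (Pow {..<n}))"
    by (intro measurable_doubly_joined[where d = d] measurable_others) simp
  moreover have "(\<lambda>B. if card B = d then B else {..<d})
      \<in> measurable (count_space (Pow {..<n})) (count_space (server_samples n d))"
    using samples by (auto simp: server_samples_def)
  ultimately have F: "F \<in> measurable (others d) (count_space (server_samples n d))"
    unfolding F_def Let_def init by (rule measurable_compose)
  have "G \<inter> {\<omega> \<in> space M. sampled (W \<omega>) d = F \<omega>} \<subseteq> reach_event M n init W T 3"
  proof
    fix \<omega> assume \<omega>: "\<omega> \<in> G \<inter> {\<omega> \<in> space M. sampled (W \<omega>) d = F \<omega>}"
    then have "\<exists>t\<in>{0..\<delta>}. 0 < occupancy n init (W \<omega>) 3 t"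
      using measurable_space[OF sampled_measurable, of \<omega>] samples
      by (intro occupancy_3_pos[OF init, of d]) (auto simp: G_def F_def Let_def less_imp_le)
    then show "\<omega> \<in> reach_event M n init W T 3"
      using \<omega> \<delta> by (force simp: reach_event_def)
  qed
  then have "prob (G \<inter> {\<omega> \<in> space M. sampled (W \<omega>) d = F \<omega>}) \<le> prob (reach_event M n init W T 3)"
    by (rule finite_measure_mono) (rule reach_event_measurable)
  then show ?thesis
    using prob_sampled_eq_random(2)[OF prob_early_arrivals_late_departures(1)[OF \<delta>(1)] F]
      prob_early_arrivals_late_departures(2)[OF \<delta>(1)]
    by (simp add: G_def)
qed

end

section \<open>Asymptotics\<close>

text \<open>The bound \<open>(e * n / d) ^ d\<close>: in the expansion of \<open>(1 + x) ^ n\<close>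
  at \<open>x = d / n\<close> the term of index \<open>d\<close> is at most the whole sum, which is
  at most \<open>exp (n * x) = exp d\<close>.\<close>

lemma binomial_le_exp:
  assumes "1 \<le> d" "d \<le> n"
  shows "real (n choose d) \<le> exp (real d - real d * ln (real d / real n))"
proof -
  let ?x = "real d / real n"
  have x: "0 < ?x" "0 < real n" using assms by auto
  have "real (n choose d) * ?x ^ d = (\<lambda>k. real (n choose k) * ?x ^ k * 1 ^ (n - k)) d" by simp
  also have "\<dots> \<le> (\<Sum>k\<le>n. real (n choose k) * ?x ^ k * 1 ^ (n - k))"
    using assms by (intro member_le_sum) auto
  also have "\<dots> = (?x + 1) ^ n" by (simp add: binomial_ring)
  also have "\<dots> \<le> exp ?x ^ n"
    using x by (intro power_mono) (auto simp: add.commute)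
  also have "\<dots> = exp (real d)" using x by (simp flip: exp_of_nat_mult)
  finally have "real (n choose d) \<le> exp (real d) / ?x ^ d" using x by (simp add: field_simps)
  also have "?x ^ d = exp (real d * ln ?x)"
    using x by (simp add: exp_of_nat_mult del: ln_div)
  finally show ?thesis by (simp only: exp_diff)
qed

section \<open>Sign of the large deviation exponent\<close>

text \<open>This is \<open>ln y \<le> y - 1\<close> at \<open>y = 1 / z\<close>, with equality only
  at 1.\<close>

lemma ell_nonneg: "0 < z \<Longrightarrow> 0 \<le> ell z"
  and ell_pos: "0 < z \<Longrightarrow> z \<noteq> 1 \<Longrightarrow> 0 < ell z"
proof -
  have eq: "ell z = z * ((1 / z - 1) - ln (1 / z))" if "0 < z"
    using that by (simp add: ell_def ln_div field_simps)
  show "0 \<le> ell z" if "0 < z"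
    using eq[OF that] ln_le_minus_one[of "1 / z"] that by simp
  show "0 < ell z" if "0 < z" "z \<noteq> 1"
  proof -
    have "ln (1 / z) < 1 / z - 1"
      using ln_le_minus_one[of "1 / z"] ln_eq_minus_one[of "1 / z"] that by fastforce
    then show ?thesis using eq[OF that(1)] that(1) by simp
  qed
qed

text \<open>The root exceeds both 2 and \<open>1 / T\<close>. So the first argument of
  \<open>ell\<close> is above 1, which gives strictness, and the second is positive, where
  \<open>ell\<close> is nonnegative.\<close>

lemma large_deviation_exponent_neg:
  assumes "0 < T"
  shows "- T * ell ((1 / T + sqrt (4 + 1 / T\<^sup>2)) / 2) - T * ell ((- (1 / T) + sqrt (4 + 1 / T\<^sup>2)) / 2) < 0"
proof -
  have "sqrt (2\<^sup>2) < sqrt (4 + 1 / T\<^sup>2)" using assms by (subst real_sqrt_less_iff) simp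
  moreover have "sqrt ((1 / T)\<^sup>2) < sqrt (4 + 1 / T\<^sup>2)"
    by (subst real_sqrt_less_iff) (simp add: power_divide)
  ultimately have s: "2 < sqrt (4 + 1 / T\<^sup>2)" "1 / T < sqrt (4 + 1 / T\<^sup>2)" using assms by simp_all
  moreover have "0 < 1 / T" using assms by simp
  ultimately have z: "2 < 1 / T + sqrt (4 + 1 / T\<^sup>2)" "0 < - (1 / T) + sqrt (4 + 1 / T\<^sup>2)"
    by linarith+
  then have "0 < ell ((1 / T + sqrt (4 + 1 / T\<^sup>2)) / 2)"
    "0 \<le> ell ((- (1 / T) + sqrt (4 + 1 / T\<^sup>2)) / 2)"
    by (auto intro!: ell_pos ell_nonneg)
  then have "0 < T * ell ((1 / T + sqrt (4 + 1 / T\<^sup>2)) / 2)"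
    "0 \<le> T * ell ((- (1 / T) + sqrt (4 + 1 / T\<^sup>2)) / 2)"
    using assms by simp_all
  then show ?thesis by linarith
qed

section \<open>The logarithmic limit\<close>

text \<open>For fixed \<open>\<delta>\<close> the normalised logarithm of the lower bound tends to
  \<open>-\<delta>\<close>, while \<open>P n \<le> 1\<close> bounds the limit above by 0;
  \<open>\<delta>\<close> is arbitrarily small.\<close>

lemma ln_prob_div_tendsto_0:
  fixes P lam :: "nat \<Rightarrow> real" and d :: "nat \<Rightarrow> nat"
  assumes "0 < T" and d: "\<And>n. 1 \<le> n \<Longrightarrow> 1 \<le> d n \<and> d n \<le> n"
    and small: "(\<lambda>n. real (d n)) \<in> o(\<lambda>n. real n)" and lam: "lam \<longlonglongrightarrow> 1"
    and le1: "\<And>n. P n \<le> 1"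
    and ge: "\<And>n \<delta>. 1 \<le> n \<Longrightarrow> 0 < \<delta> \<Longrightarrow> \<delta> \<le> T \<Longrightarrow>
      (1 - exp (- \<delta> * (real n * lam n) / real (Suc (d n)))) ^ Suc (d n) * exp (- \<delta>) ^ Suc (n + d n)
        / real (n choose d n) \<le> P n"
  shows "eventually (\<lambda>n. 0 < P n) sequentially" and "(\<lambda>n. ln (P n) / real n) \<longlonglongrightarrow> 0"
proof -
  define x where "x n = real (d n) / real n" for n
  have x0: "x \<longlonglongrightarrow> 0" unfolding x_def by (rule smalloD_tendsto[OF small])
  \<comment> \<open>The limit of \<open>x * ln x\<close> at 0 is taken from the right, so
    \<open>x\<close> must approach 0 through positive values.\<close>
  have "eventually (\<lambda>n. 0 < x n) sequentially"
    using eventually_ge_at_top[of 1] by eventually_elim (use d in \<open>force simp: x_def\<close>)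
  with x0 have x: "filterlim x (at_right 0) sequentially"
    by (auto simp: filterlim_at elim: eventually_mono)
  have "((\<lambda>x::real. x * ln x) \<longlongrightarrow> 0) (at_right 0)" by real_asymp
  from filterlim_compose[OF this x] have xlnx: "(\<lambda>n. x n * ln (x n)) \<longlonglongrightarrow> 0" .
  have lower: "eventually (\<lambda>n. 0 < P n \<and>
      - (x n + 1 / real n) * (ln 2 + \<delta>) - \<delta> - x n + x n * ln (x n) \<le> ln (P n) / real n) sequentially"
    if \<delta>: "0 < \<delta>" "\<delta> \<le> T" for \<delta>
  proof -
    have "(\<lambda>n. \<delta> * lam n) \<longlonglongrightarrow> \<delta> * 1" by (intro tendsto_intros lam)
    moreover have "(\<lambda>n. x n + 1 / real n) \<longlonglongrightarrow> 0 + 0" by (intro tendsto_add x0 lim_1_over_n)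
    ultimately have "(\<lambda>n. \<delta> * lam n - (x n + 1 / real n)) \<longlonglongrightarrow> \<delta> * 1 - (0 + 0)" by (rule tendsto_diff)
    then have "eventually (\<lambda>n. 0 < \<delta> * lam n - (x n + 1 / real n)) sequentially"
      by (rule order_tendstoD) (use \<delta> in simp)
    then show ?thesis using eventually_ge_at_top[of 1]
    proof eventually_elim
      case (elim n)
      then have n: "0 < real n" by simp
      \<comment> \<open>The mean number of arrivals in a slot of length
        \<open>\<delta> / (d + 1)\<close> is at least 1, so a gap overruns its slot with probability
        at most \<open>exp (- 1)\<close>, which is at most 1/2.\<close>
      have "real (Suc (d n)) \<le> \<delta> * (real n * lam n)"
        using elim n by (simp add: x_def field_simps)
      then have "1 \<le> \<delta> * (real n * lam n) / real (Suc (d n))" by (simp add: field_simps)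
      then have "exp (- \<delta> * (real n * lam n) / real (Suc (d n))) \<le> exp (- 1)" by simp
      also have "\<dots> \<le> 1 / 2" using exp_ge_add_one_self[of 1] by (simp add: exp_minus field_simps)
      finally have half: "1 / 2 \<le> 1 - exp (- \<delta> * (real n * lam n) / real (Suc (d n)))" by simp
      have C: "0 < real (n choose d n)" using d elim by simp
      \<comment> \<open>The gap factor is weakened to 1/2 and the binomial coefficient to its
        exponential bound, which makes the logarithm explicit.\<close>
      let ?L = "(1 / 2) ^ Suc (d n) * exp (- \<delta>) ^ Suc (n + d n) / exp (real (d n) - real (d n) * ln (x n))"
      have q: "?L \<le> q ^ Suc (d n) * exp (- \<delta>) ^ Suc (n + d n) / real (n choose d n)" if "1 / 2 \<le> q" for q
      proof (rule frac_le)
        show "(1 / 2) ^ Suc (d n) * exp (- \<delta>) ^ Suc (n + d n) \<le> q ^ Suc (d n) * exp (- \<delta>) ^ Suc (n + d n)"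
          using that by (intro mult_right_mono power_mono) auto
        show "0 \<le> q ^ Suc (d n) * exp (- \<delta>) ^ Suc (n + d n)"
          using that by (intro mult_nonneg_nonneg zero_le_power) auto
        show "real (n choose d n) \<le> exp (real (d n) - real (d n) * ln (x n))"
          unfolding x_def using binomial_le_exp[of "d n" n] d[of n] elim by simp
      qed (rule C)
      have LP: "?L \<le> P n" using q[OF half] ge[OF elim(2) \<delta>] by (rule order_trans)
      have L0: "0 < ?L" by simp
      have "ln ?L = - real (Suc (d n)) * ln 2 - real (Suc (n + d n)) * \<delta> - (real (d n) - real (d n) * ln (x n))"
        by (subst ln_div; (subst ln_mult)?) (auto simp: ln_realpow ln_div algebra_simps simp del: power_Suc of_nat_Suc)
      also have "\<dots> = - (real (d n) + 1) * ln 2 - (real n + real (d n) + 1) * \<delta>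
          - (real (d n) - real (d n) * ln (x n))"
        by (simp only: of_nat_Suc of_nat_add add.commute add.left_commute)
      finally have "ln ?L = \<dots>" .
      moreover have "\<dots> / real n = - (x n + 1 / real n) * (ln 2 + \<delta>) - \<delta> - x n + x n * ln (x n)"
        using n by (simp add: x_def add_divide_distrib diff_divide_distrib algebra_simps del: ln_div)
      ultimately have "ln ?L / real n = - (x n + 1 / real n) * (ln 2 + \<delta>) - \<delta> - x n + x n * ln (x n)"
        by (simp only:)
      moreover have P0: "0 < P n" by (rule less_le_trans[OF L0 LP])
      have "ln ?L / real n \<le> ln (P n) / real n"
        by (rule divide_right_mono[OF iffD2[OF ln_le_cancel_iff[OF L0 P0] LP]]) simp
      ultimately show ?case by (simp only: P0 simp_thms)
    qed
  qed
  show "eventually (\<lambda>n. 0 < P n) sequentially"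
    using lower[of T] \<open>0 < T\<close> by (auto elim: eventually_mono)
  show "(\<lambda>n. ln (P n) / real n) \<longlonglongrightarrow> 0"
  proof (rule order_tendstoI)
    fix a :: real assume "0 < a"
    have "ln (P n) / real n \<le> 0" if "0 < P n" for n
      using that le1[of n] by (simp add: divide_le_0_iff)
    \<comment> \<open>The choice \<open>\<delta> = T\<close> serves only to have \<open>P n\<close>
      eventually positive.\<close>
    then show "eventually (\<lambda>n. ln (P n) / real n < a) sequentially"
      using lower[of T] \<open>0 < T\<close> \<open>0 < a\<close> by (force elim!: eventually_mono)
  next
    fix a :: real assume "a < 0"
    \<comment> \<open>Half of \<open>-a\<close> keeps the limit \<open>-\<delta>\<close> strictly
      above \<open>a\<close>; the minimum respects the time horizon.\<close>
    define \<delta> where "\<delta> = min T (- a / 2)"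
    have \<delta>: "0 < \<delta>" "\<delta> \<le> T" "a < - \<delta>" using \<open>0 < T\<close> \<open>a < 0\<close> by (auto simp: \<delta>_def min_def)
    have "(\<lambda>n. - (x n + 1 / real n) * (ln 2 + \<delta>) - \<delta> - x n + x n * ln (x n))
        \<longlonglongrightarrow> - (0 + 0) * (ln 2 + \<delta>) - \<delta> - 0 + 0"
      by (intro tendsto_intros x0 xlnx lim_1_over_n)
    then have "eventually (\<lambda>n. a < - (x n + 1 / real n) * (ln 2 + \<delta>) - \<delta> - x n + x n * ln (x n)) sequentially"
      by (rule order_tendstoD) (use \<delta> in simp)
    then show "eventually (\<lambda>n. a < ln (P n) / real n) sequentially"
      using lower[OF \<delta>(1,2)] by eventually_elim linarith
  qed
qed

theorem mainTheorem4:
  fixes T :: real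
    and d :: "nat \<Rightarrow> nat"
    and lam :: "nat \<Rightarrow> real"
    and M :: "nat \<Rightarrow> 'a measure"
    and init :: "nat \<Rightarrow> nat list"
    and W :: "nat \<Rightarrow> 'a \<Rightarrow> jsq_input"
  assumes "0 < T"
    and "\<And>n. 1 \<le> n \<Longrightarrow> d n \<in> {1..n}"
    and "filterlim d at_top sequentially"
    and "lam \<longlonglongrightarrow> 1"
    and "\<And>n. 1 \<le> n \<Longrightarrow> jsq_system (M n) n (d n) (lam n) (init n) (W n)"
    and "\<And>n. 1 \<le> n \<Longrightarrow>
           AE \<omega> in M n. \<forall>i\<ge>1. occupancy n (init n) (W n \<omega>) i 0 = (if i = 1 then 1 else 0)"
    and "(\<lambda>n. real (d n)) \<in> o(\<lambda>n. real n)"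
  shows "((\<lambda>n. ereal (1 / real n) *
             elog (measure (M n) (reach_event (M n) n (init n) (W n) T 3))) \<longlonglongrightarrow> 0)
         \<and> liminf (\<lambda>n. ereal (1 / real n) *
             elog (measure (M n) (reach_event (M n) n (init n) (W n) T 3)))
           > ereal (- T * ell ((1 / T + sqrt (4 + 1 / T\<^sup>2)) / 2)
                    - T * ell ((- (1 / T) + sqrt (4 + 1 / T\<^sup>2)) / 2))"
proof
  define P where "P n = measure (M n) (reach_event (M n) n (init n) (W n) T 3)" for n
  \<comment> \<open>The hypotheses say nothing about \<open>M 0\<close>.\<close>
  define Q where "Q n = (if n = 0 then 1 else P n)" for n
  have sys: "jsq_system (M n) n (d n) (lam n) (init n) (W n)" if "1 \<le> n" for n
    using assms(5) that .
  have "Q n \<le> 1" for n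
    using prob_space.prob_le_1[OF jsq_system.axioms(1)[OF sys[of n]]] by (simp add: Q_def P_def)
  moreover have "(1 - exp (- \<delta> * (real n * lam n) / real (Suc (d n)))) ^ Suc (d n) * exp (- \<delta>) ^ Suc (n + d n)
      / real (n choose d n) \<le> Q n" if "1 \<le> n" "0 < \<delta>" "\<delta> \<le> T" for n \<delta>
    using jsq_system.prob_reach_event_3_ge[OF sys assms(6), OF that(1) that(1) less_imp_le[OF that(2)] that(3)] that(1)
    by (simp only: Q_def P_def) simp
  moreover have "1 \<le> d n \<and> d n \<le> n" if "1 \<le> n" for n
    using assms(2)[OF that] by simp
  ultimately have pos: "eventually (\<lambda>n. 0 < Q n) sequentially" and lim: "(\<lambda>n. ln (Q n) / real n) \<longlonglongrightarrow> 0"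
    using ln_prob_div_tendsto_0[OF assms(1) _ assms(7,4)] by blast+
  \<comment> \<open>Eventual positivity rules out the value -\<infinity> of \<open>elog\<close>, so
    the real limit transfers to the extended reals.\<close>
  have "eventually (\<lambda>n. ereal (ln (Q n) / real n) = ereal (1 / real n) * elog (P n)) sequentially"
    using pos eventually_ge_at_top[of 1] by eventually_elim (simp add: Q_def elog_def)
  from iffD1[OF tendsto_cong[OF this] tendsto_ereal[OF lim]]
  have "(\<lambda>n. ereal (1 / real n) * elog (P n)) \<longlonglongrightarrow> 0"
    by (simp only: zero_ereal_def)
  then show lim0: "(\<lambda>n. ereal (1 / real n) *
      elog (measure (M n) (reach_event (M n) n (init n) (W n) T 3))) \<longlonglongrightarrow> 0"
    by (simp only: P_def)
  have "liminf (\<lambda>n. ereal (1 / real n) *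
      elog (measure (M n) (reach_event (M n) n (init n) (W n) T 3))) = 0"
    using lim_imp_Liminf[OF _ lim0] by simp
  then show "ereal (- T * ell ((1 / T + sqrt (4 + 1 / T\<^sup>2)) / 2)
      - T * ell ((- (1 / T) + sqrt (4 + 1 / T\<^sup>2)) / 2)) < liminf (\<lambda>n. ereal (1 / real n) *
      elog (measure (M n) (reach_event (M n) n (init n) (W n) T 3)))"
    using large_deviation_exponent_neg[OF assms(1)] by simp
qed

end
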